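(* For all positive integers $n,k$, \[ f(n,k)\le\sum_{m=1}^{k-1}g(n,m)+kn. \]
   Context: An antichain in $2^{[n]}$ (where $[n]=\{1,\dots,n\}$) is a family of subsets of $[n]$ none of which is contained in another. There is an unknown antichain $\mathcal{S}\subseteq 2^{[n]}$ with exactly $k$ members. A query is a set $Q\subseteq[n]$, answered YES if $Q\supseteq S$ for some $S\in\mathcal{S}$ and NO otherwise. $f(n,k)$ is the smallest $q$ such that some adaptive strategy (queries may depend on previous answers) determines every $k$-member antichain $\mathcal{S}$ uniquely using at most $q$ queries in the worst case. For a family $\mathcal{F}\subseteq 2^{[n]}$, a set $A\subseteq[n]$ is a cover of $\mathcal{F}$ if $A\cap F\ne\emptyset$ for all $F\in\mathcal{F}$; it is a minimal cover if it is a cover and no proper subset of it is a cover. $MC(\mathcal{F})$ denotes the family of minimal covers of $\mathcal{F}$, and $g(n,m)=\max\{|MC(\mathcal{F})| : \mathcal{F}\subseteq 2^{[n]},\ |\mathcal{F}|=m\}$. *)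

theory Defs
  imports Complex_Main
begin

definition antichains :: "nat \<Rightarrow> nat \<Rightarrow> nat set set set" where
  "antichains n k =
     {S. S \<subseteq> Pow {1..n} \<and> (\<forall>A\<in>S. \<forall>B\<in>S. A \<subseteq> B \<longrightarrow> A = B) \<and> card S = k}"

definition answer :: "nat set set \<Rightarrow> nat set \<Rightarrow> bool" where
  "answer S Q \<longleftrightarrow> (\<exists>A\<in>S. A \<subseteq> Q)"

text \<open>An adaptive strategy is a decision tree: it either stops and announces a family, or asks
  a query and continues with the first subtree on YES and with the second one on NO.\<close>

datatype strategy = Announce "nat set set" | Ask "nat set" strategy strategy

fun queries_within :: "nat \<Rightarrow> strategy \<Rightarrow> bool" where
  "queries_within n (Announce R) \<longleftrightarrow> True"
| "queries_within n (Ask Q y z) \<longleftrightarrow> Q \<subseteq> {1..n} \<and> queries_within n y \<and> queries_within n z"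

fun announced :: "strategy \<Rightarrow> nat set set \<Rightarrow> nat set set" where
  "announced (Announce R) S = R"
| "announced (Ask Q y z) S = (if answer S Q then announced y S else announced z S)"

fun num_queries :: "strategy \<Rightarrow> nat set set \<Rightarrow> nat" where
  "num_queries (Announce R) S = 0"
| "num_queries (Ask Q y z) S = Suc (if answer S Q then num_queries y S else num_queries z S)"

definition identifiable_within :: "nat \<Rightarrow> nat \<Rightarrow> nat \<Rightarrow> bool" where
  "identifiable_within n k q \<longleftrightarrow>
     (\<exists>t. queries_within n t \<and>
          (\<forall>S\<in>antichains n k. announced t S = S \<and> num_queries t S \<le> q))"

definition f :: "nat \<Rightarrow> nat \<Rightarrow> nat" where
  "f n k = (LEAST q. identifiable_within n k q)"

definition is_cover :: "nat \<Rightarrow> nat set set \<Rightarrow> nat set \<Rightarrow> bool" where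
  "is_cover n F A \<longleftrightarrow> A \<subseteq> {1..n} \<and> (\<forall>B\<in>F. A \<inter> B \<noteq> {})"

definition MC :: "nat \<Rightarrow> nat set set \<Rightarrow> nat set set" where
  "MC n F = {A. is_cover n F A \<and> (\<forall>B. B \<subset> A \<longrightarrow> \<not> is_cover n F B)}"

text \<open>On \<^typ>\<open>nat\<close> the supremum of a finite nonempty set is its maximum, and the supremum of the
  empty set is 0; the latter occurs here exactly if \<open>m > 2 ^ n\<close>.\<close>

definition g :: "nat \<Rightarrow> nat \<Rightarrow> nat" where
  "g n m = (SUP F \<in> {F. F \<subseteq> Pow {1..n} \<and> card F = m}. card (MC n F))"

end

theory Submission
  imports Defs
begin

text \<open>
  The members of the unknown antichain are found one at a time. Suppose a set \<open>F\<close> of \<open>m < k\<close>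
  members is known. A further member contains no member of \<open>F\<close>, so its complement covers \<open>F\<close> and
  contains a minimal cover; hence querying the complements of the minimal covers of \<open>F\<close> must
  produce a YES. A queried complement contains no member of \<open>F\<close>, so the YES comes from a new
  member, and \<open>n\<close> further queries isolate one by deleting elements one after the other. For
  \<open>m = 0\<close> the only minimal cover is empty, and the answer to the query \<open>{1..n}\<close> is known in
  advance.
\<close>

text \<open>Generalises \<open>identifiable_within\<close> from all antichains to any set
  \<open>P\<close> of candidates, so that the candidates still possible after some answers can be
  treated as a problem of their own.\<close>

definition solvable :: "nat \<Rightarrow> nat set set set \<Rightarrow> nat \<Rightarrow> bool" where
  "solvable n P q \<longleftrightarrow>
     (\<exists>t. queries_within n t \<and> (\<forall>S\<in>P. announced t S = S \<and> num_queries t S \<le> q))"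

lemma solvable_mono: "solvable n P q \<Longrightarrow> P' \<subseteq> P \<Longrightarrow> q \<le> q' \<Longrightarrow> solvable n P' q'"
  unfolding solvable_def by (meson le_trans subsetD)

lemma solvable_subset_singleton:
  assumes "P \<subseteq> {S}"
  shows "solvable n P q"
  unfolding solvable_def using assms by (intro exI[of _ "Announce S"]) auto

lemma solvable_ask:
  assumes Q: "Q \<subseteq> {1..n}"
    and yes: "solvable n {S\<in>P. answer S Q} q"
    and no: "solvable n {S\<in>P. \<not> answer S Q} q"
  shows "solvable n P (Suc q)"
proof -
  obtain y where "queries_within n y"
    "\<forall>S\<in>{S\<in>P. answer S Q}. announced y S = S \<and> num_queries y S \<le> q"
    using yes unfolding solvable_def by blast
  moreover obtain z where "queries_within n z"
    "\<forall>S\<in>{S\<in>P. \<not> answer S Q}. announced z S = S \<and> num_queries z S \<le> q"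
    using no unfolding solvable_def by blast
  ultimately show ?thesis
    unfolding solvable_def using Q by (intro exI[of _ "Ask Q y z"]) auto
qed

lemma answer_mono: "answer S Q \<Longrightarrow> Q \<subseteq> Q' \<Longrightarrow> answer S Q'"
  unfolding answer_def by blast

text \<open>In the next lemma \<open>X\<close> is the set of elements that have not yet been tried for deletion.\<close>

lemma solvable_by_deletion:
  assumes "finite X" "Q \<subseteq> {1..n}"
    and "\<And>S. S \<in> P \<Longrightarrow> answer S Q"
    and "\<And>S x. S \<in> P \<Longrightarrow> x \<in> Q - X \<Longrightarrow> \<not> answer S (Q - {x})"
    and "\<And>A. A \<subseteq> Q \<Longrightarrow> solvable n {S\<in>P. A \<in> S} q"
  shows "solvable n P (card X + q)"
  using assms
proof (induction X arbitrary: Q P rule: finite_induct)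
  case empty
  have "Q \<in> S" if S: "S \<in> P" for S
  proof -
    obtain A where A: "A \<in> S" "A \<subseteq> Q"
      using empty.prems(2)[OF S] unfolding answer_def by blast
    \<comment> \<open>If \<open>A\<close> missed \<open>x\<close>, it would witness a YES for
      \<open>Q - {x}\<close>. Hence \<open>Q\<close> itself is the member found.\<close>
    have "x \<in> A" if "x \<in> Q" for x
      using empty.prems(3)[OF S, of x] that A unfolding answer_def by blast
    then show ?thesis using A by (metis subsetI subset_antisym)
  qed
  then have "{S\<in>P. Q \<in> S} = P" by blast
  then show ?case using empty.prems(4)[of Q] by simp
next
  case (insert x X)
  \<comment> \<open>On YES, \<open>x\<close> is dropped for good; elements that could not be deleted
    from \<open>Q\<close> cannot be deleted from the smaller set either.\<close>
  have yes: "solvable n {S\<in>P. answer S (Q - {x})} (card X + q)"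
  proof (rule insert.IH[of "Q - {x}"])
    show "\<not> answer S (Q - {x} - {y})"
      if "S \<in> {S\<in>P. answer S (Q - {x})}" "y \<in> Q - {x} - X" for S y
    proof -
      have "\<not> answer S (Q - {y})" using insert.prems(3)[of S y] that by blast
      then show ?thesis using answer_mono[of S "Q - {x} - {y}" "Q - {y}"] by blast
    qed
    show "solvable n {S \<in> {S\<in>P. answer S (Q - {x})}. A \<in> S} q" if "A \<subseteq> Q - {x}" for A
      by (rule solvable_mono[OF insert.prems(4)[of A]]) (use that in auto)
  qed (use insert.prems(1) in auto)
  \<comment> \<open>On NO, \<open>Q\<close> is kept, and the answer itself records that
    \<open>x\<close> cannot be deleted.\<close>
  have no: "solvable n {S\<in>P. \<not> answer S (Q - {x})} (card X + q)"
  proof (rule insert.IH[of Q])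
    show "\<not> answer S (Q - {y})"
      if "S \<in> {S\<in>P. \<not> answer S (Q - {x})}" "y \<in> Q - X" for S y
      using insert.prems(3)[of S y] that by (cases "y = x") auto
    show "solvable n {S \<in> {S\<in>P. \<not> answer S (Q - {x})}. A \<in> S} q" if "A \<subseteq> Q" for A
      by (rule solvable_mono[OF insert.prems(4)[of A]]) (use that in auto)
  qed (use insert.prems(1,2) in auto)
  have "Q - {x} \<subseteq> {1..n}" using insert.prems(1) by blast
  from solvable_ask[OF this yes no] show ?case using insert.hyps by simp
qed

text \<open>The sets in \<open>C\<close> are queried in turn until the first YES, after which
  \<open>q\<close> queries suffice. If all answers are NO, no candidate is left.\<close>

lemma solvable_by_search:
  assumes "finite C" "\<And>Q. Q \<in> C \<Longrightarrow> Q \<subseteq> {1..n}"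
    and "\<And>S. S \<in> P \<Longrightarrow> \<exists>Q\<in>C. answer S Q"
    and "\<And>Q. Q \<in> C \<Longrightarrow> solvable n {S\<in>P. answer S Q} q"
  shows "solvable n P (card C + q)"
  using assms
proof (induction C arbitrary: P rule: finite_induct)
  case empty
  then have "P = {}" by blast
  then show ?case by (simp add: solvable_subset_singleton)
next
  case (insert Q C)
  have yes: "solvable n {S\<in>P. answer S Q} (card C + q)"
    by (rule solvable_mono[OF insert.prems(3)[of Q]]) auto
  have no: "solvable n {S\<in>P. \<not> answer S Q} (card C + q)"
  proof (rule insert.IH)
    show "solvable n {S \<in> {S\<in>P. \<not> answer S Q}. answer S R} q" if "R \<in> C" for R
      by (rule solvable_mono[OF insert.prems(3)[of R]]) (use that in auto)
  qed (use insert.prems(1,2) in auto)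
  from solvable_ask[OF _ yes no] show ?case
    using insert.hyps insert.prems(1)[of Q] by simp
qed

lemma finite_MC: "finite (MC n F)"
  by (rule finite_subset[of _ "Pow {1..n}"]) (auto simp: MC_def is_cover_def)

lemma card_MC_le_g:
  assumes "F \<subseteq> Pow {1..n}"
  shows "card (MC n F) \<le> g n (card F)"
  unfolding g_def
proof (rule cSUP_upper)
  have "finite {F'. F' \<subseteq> Pow {1..n} \<and> card F' = card F}"
    by (rule finite_subset[of _ "Pow (Pow {1..n})"]) auto
  then show "bdd_above ((\<lambda>F. card (MC n F)) ` {F'. F' \<subseteq> Pow {1..n} \<and> card F' = card F})"
    by simp
qed (use assms in simp)

lemma cover_contains_minimal_cover:
  assumes "is_cover n F A"
  shows "\<exists>B\<in>MC n F. B \<subseteq> A"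
proof -
  have "finite {B. is_cover n F B}"
    by (rule finite_subset[of _ "Pow {1..n}"]) (auto simp: is_cover_def)
  from finite_has_minimal2[OF this, of A] assms
  obtain B where "is_cover n F B" "B \<subseteq> A" "\<forall>B'. is_cover n F B' \<longrightarrow> B' \<subseteq> B \<longrightarrow> B = B'"
    by blast
  then show ?thesis unfolding MC_def by blast
qed

lemma answer_complement_minimal_cover:
  assumes S: "S \<in> antichains n k" and "F \<subset> S"
  shows "\<exists>Q\<in>(\<lambda>A. {1..n} - A) ` MC n F. answer S Q"
proof -
  obtain B where B: "B \<in> S" "B \<notin> F" using \<open>F \<subset> S\<close> by blast
  have "is_cover n F ({1..n} - B)"
    unfolding is_cover_def
  proof (intro conjI ballI)
    fix D assume "D \<in> F"
    \<comment> \<open>\<open>D\<close> and \<open>B\<close> are distinct members of the antichain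
      \<open>S\<close>.\<close>
    then have "\<not> D \<subseteq> B" "D \<subseteq> {1..n}"
      using B S \<open>F \<subset> S\<close> unfolding antichains_def by blast+
    then show "({1..n} - B) \<inter> D \<noteq> {}" by blast
  qed simp
  then obtain A where A: "A \<in> MC n F" "A \<subseteq> {1..n} - B"
    using cover_contains_minimal_cover by blast
  have "B \<subseteq> {1..n}" using S B(1) unfolding antichains_def by blast
  then have "B \<subseteq> {1..n} - A" using A(2) by blast
  then have "answer S ({1..n} - A)" using B(1) unfolding answer_def by blast
  then show ?thesis using A(1) by (rule bexI[OF _ imageI])
qed

text \<open>Any member found inside \<open>Q\<close> by deletion lies outside \<open>F\<close>, so
  \<open>n\<close> queries enlarge the known part by one. Deletion starts with every element
  untried, which makes its condition on tried elements vacuous.\<close>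

lemma solvable_extend:
  assumes F: "F \<subseteq> Pow {1..n}" and Q: "Q \<subseteq> {1..n}"
    and new: "\<And>D. D \<in> F \<Longrightarrow> \<not> D \<subseteq> Q"
    and next_stage: "\<And>F'. F' \<subseteq> Pow {1..n} \<Longrightarrow> card F' = Suc (card F) \<Longrightarrow>
      solvable n {S \<in> antichains n k. F' \<subseteq> S} q"
  shows "solvable n {S \<in> antichains n k. F \<subseteq> S \<and> answer S Q} (n + q)"
proof -
  have "solvable n {S \<in> antichains n k. F \<subseteq> S \<and> answer S Q} (card {1..n} + q)"
  proof (rule solvable_by_deletion[of _ Q])
    fix A assume A: "A \<subseteq> Q"
    have "finite F" using F finite_subset by blast
    moreover have "A \<notin> F" using new A by blast
    ultimately have "solvable n {S \<in> antichains n k. insert A F \<subseteq> S} q"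
      using next_stage[of "insert A F"] A F Q by simp
    then show "solvable n {S \<in> {S \<in> antichains n k. F \<subseteq> S \<and> answer S Q}. A \<in> S} q"
      by (rule solvable_mono) auto
  qed (use Q in auto)
  then show ?thesis by simp
qed

text \<open>Induction on the number of members still missing. With \<open>m\<close> members known,
  at most \<open>g n m\<close> queries produce a YES and \<open>n\<close> more isolate a new
  member.\<close>

lemma solvable_known_members:
  assumes "F \<subseteq> Pow {1..n}" "1 \<le> card F" "card F \<le> k"
  shows "solvable n {S \<in> antichains n k. F \<subseteq> S} (\<Sum>m=card F..<k. g n m + n)"
  using assms
proof (induction "k - card F" arbitrary: F)
  case 0
  have "S = F" if "S \<in> antichains n k" "F \<subseteq> S" for S
  proof -
    have "finite S" "card S = k"
      using that finite_subset[of S "Pow {1..n}"] unfolding antichains_def by auto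
    then show ?thesis using card_subset_eq[of S F] that 0 by simp
  qed
  then show ?case by (intro solvable_subset_singleton[of _ F]) auto
next
  case (Suc d)
  let ?q = "\<Sum>m=Suc (card F)..<k. g n m + n"
  let ?C = "(\<lambda>A. {1..n} - A) ` MC n F"
  let ?P = "{S \<in> antichains n k. F \<subseteq> S}"
  have "card F < k" using Suc.hyps(2) by simp
  have "solvable n ?P (card ?C + (n + ?q))"
  proof (rule solvable_by_search)
    show "finite ?C" using finite_MC by simp
    show "Q \<subseteq> {1..n}" if "Q \<in> ?C" for Q using that by blast
    show "\<exists>Q\<in>?C. answer S Q" if "S \<in> ?P" for S
    proof (rule answer_complement_minimal_cover)
      show "S \<in> antichains n k" using that by simp
      then have "card S = k" unfolding antichains_def by simp
      then show "F \<subset> S" using that \<open>card F < k\<close> by auto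
    qed
    fix Q assume "Q \<in> ?C"
    then obtain A where A: "A \<in> MC n F" "Q = {1..n} - A" by blast
    have "solvable n {S \<in> antichains n k. F \<subseteq> S \<and> answer S Q} (n + ?q)"
    proof (rule solvable_extend)
      \<comment> \<open>The cover \<open>A\<close> meets \<open>D\<close>, and \<open>Q\<close> is
        disjoint from \<open>A\<close>.\<close>
      show "\<not> D \<subseteq> Q" if "D \<in> F" for D
        using A that unfolding MC_def is_cover_def by blast
      show "solvable n {S \<in> antichains n k. F' \<subseteq> S} ?q"
        if "F' \<subseteq> Pow {1..n}" "card F' = Suc (card F)" for F'
        using Suc.hyps(1)[of F'] Suc.hyps(2) that by simp
    qed (use A Suc.prems in auto)
    then show "solvable n {S \<in> ?P. answer S Q} (n + ?q)"
      by (rule solvable_mono) auto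
  qed
  moreover have "card ?C \<le> g n (card F)"
    using card_image_le[OF finite_MC] card_MC_le_g[OF Suc.prems(1)] le_trans by blast
  ultimately show ?case
    using \<open>card F < k\<close> by (elim solvable_mono) (auto simp: sum.atLeast_Suc_lessThan)
qed

theorem theorem1p3:
  fixes n k :: nat
  assumes "n \<ge> 1" and "k \<ge> 1"
  shows "f n k \<le> (\<Sum>m=1..k-1. g n m) + k * n"
proof -
  let ?q = "\<Sum>m=1..<k. g n m + n"
  \<comment> \<open>The first member is isolated by deletion from \<open>{1..n}\<close> without any
    search, which is why the sum over \<open>g\<close> starts at 1.\<close>
  have "solvable n {S \<in> antichains n k. {} \<subseteq> S \<and> answer S {1..n}} (n + ?q)"
  proof (rule solvable_extend)
    show "solvable n {S \<in> antichains n k. F \<subseteq> S} ?q"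
      if "F \<subseteq> Pow {1..n}" "card F = Suc (card {})" for F
      using solvable_known_members[of F n k] that assms(2) by simp
  qed auto
  moreover have "answer S {1..n}" if "S \<in> antichains n k" for S
  proof -
    have "S \<noteq> {}" "S \<subseteq> Pow {1..n}"
      using that assms(2) unfolding antichains_def by auto
    then show ?thesis unfolding answer_def by blast
  qed
  ultimately have "solvable n (antichains n k) (n + ?q)"
    by (elim solvable_mono) auto
  then have "f n k \<le> n + ?q"
    unfolding f_def solvable_def identifiable_within_def by (rule Least_le)
  \<comment> \<open>Each of the \<open>k\<close> members costs \<open>n\<close> deletion queries:
    one \<open>n\<close> for the first and \<open>k - 1\<close> inside \<open>?q\<close>.\<close>
  also have "n + ?q = (\<Sum>m=1..<k. g n m) + (n + (k - 1) * n)"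
    by (simp add: sum.distrib)
  also have "n + (k - 1) * n = k * n"
    using assms(2) by (cases k) auto
  also have "{1..<k} = {1..k-1}" using assms(2) by auto
  finally show ?thesis .
qed

end
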